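(* Let $g>0$, let $M\subset\mathbf C$ be compact, and let $H$ be the operator on $l^2(\mathbf Z)$ given by $(Hf)_m=e^{-g}f_{m-1}+e^{g}f_{m+1}+V_mf_m$, where $V$ is a $(\mathbf Z,M)$ pseudo-ergodic potential. If $n,p\ge1$, $\alpha\in M^n$ and $\beta\in M^p$, then $$I_\alpha\cap O_\beta\subseteq\sigma_{\rm loc}(H).$$
   Context: A potential $V:\mathbf Z\to M$ is $(\mathbf Z,M)$ pseudo-ergodic if for every $\varepsilon>0$, every finite $F\subset\mathbf Z$ and every $W:F\to M$ there is $k\in\mathbf Z$ with $|W_m-V_{m+k}|<\varepsilon$ for all $m\in F$. For $\alpha=(\alpha_0,\dots,\alpha_{n-1})\in M^n$ and $\lambda\in\mathbf C$ put $$A_r=\begin{pmatrix}0&-e^{-2g}\\1&e^{-g}(\lambda-\alpha_r)\end{pmatrix}\ (0\le r\le n-1),\qquad B_\alpha(\lambda)=A_0A_1\cdots A_{n-1},$$ a $2\times2$ matrix with entries $b_{ij}(\lambda)$. Let $E^n$ be the ellipse (curve) $E^n=\{e^{i\theta}+e^{-2ng-i\theta}:\theta\in[-\pi,\pi]\}$, with $\mathrm{int}(E^n)$ the bounded open region enclosed by it and $\mathrm{ext}(E^n)$ the unbounded component of its complement. Define $$I_\alpha=\{\lambda\in\mathbf C:b_{11}(\lambda)+b_{22}(\lambda)\in\mathrm{int}(E^n)\},\qquad O_\alpha=\{\lambda\in\mathbf C:b_{11}(\lambda)+b_{22}(\lambda)\in\mathrm{ext}(E^n)\}.$$ For $\beta\in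 M^p$ the set $O_\beta$ is defined in the same way with $p$ in place of $n$. For a unit vector $f\in l^2(\mathbf Z)$, $\mathrm{var}(f)=\min_{y\in\mathbf Z}\sum_{x\in\mathbf Z}|x-y|^2|f_x|^2\in[0,\infty]$. The localized spectrum $\sigma_{\rm loc}(A)$ of a bounded operator $A$ on $l^2(\mathbf Z)$ is the set of $\lambda\in\mathbf C$ for which there is a sequence of unit vectors $f_j$ with $\|Af_j-\lambda f_j\|\to0$ and $\sup_j\mathrm{var}(f_j)<\infty$. *)

theory Defs
  imports "HOL-Analysis.Analysis"
begin

definition l2 :: "(int \<Rightarrow> complex) set" where
  "l2 = {f. (\<lambda>m. (cmod (f m))\<^sup>2) summable_on UNIV}"

text \<open>Only meaningful on \<^const>\<open>l2\<close>: elsewhere the infinite sum takes its default value 0.\<close>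

definition l2norm :: "(int \<Rightarrow> complex) \<Rightarrow> real" where
  "l2norm f = sqrt (\<Sum>\<^sub>\<infinity>m. (cmod (f m))\<^sup>2)"

text \<open>
  The second moment of the mass distribution of \<open>f\<close> about \<open>y\<close>. The sum is taken in
  \<^typ>\<open>ennreal\<close>, so it is infinite when it diverges.
\<close>

definition l2moment :: "(int \<Rightarrow> complex) \<Rightarrow> int \<Rightarrow> ennreal" where
  "l2moment f y = (\<Sum>\<^sub>\<infinity>x. ennreal ((real_of_int \<bar>x - y\<bar>)\<^sup>2 * (cmod (f x))\<^sup>2))"

text \<open>The infimum is attained, see \<open>l2var_attained\<close> below.\<close>

definition l2var :: "(int \<Rightarrow> complex) \<Rightarrow> ennreal" where
  "l2var f = (INF y. l2moment f y)"

text \<open>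
  Intended for maps that restrict to a bounded operator on \<^const>\<open>l2\<close>; such a map is represented
  by its action on all two-sided sequences.
\<close>

definition localized_spectrum ::
    "((int \<Rightarrow> complex) \<Rightarrow> (int \<Rightarrow> complex)) \<Rightarrow> complex set" where
  "localized_spectrum A = {z. \<exists>f :: nat \<Rightarrow> int \<Rightarrow> complex.
      (\<forall>j. f j \<in> l2 \<and> l2norm (f j) = 1) \<and>
      (\<lambda>j. l2norm (\<lambda>m. A (f j) m - z * f j m)) \<longlonglongrightarrow> 0 \<and>
      (SUP j. l2var (f j)) < \<infinity>}"

definition pseudo_ergodic :: "complex set \<Rightarrow> (int \<Rightarrow> complex) \<Rightarrow> bool" where
  "pseudo_ergodic M V \<longleftrightarrow> (\<forall>m. V m \<in> M) \<and>
     (\<forall>\<epsilon>>0. \<forall>F. finite F \<longrightarrow> (\<forall>W :: int \<Rightarrow> complex. (\<forall>m\<in>F. W m \<in> M) \<longrightarrow>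
        (\<exists>k. \<forall>m\<in>F. cmod (W m - V (m + k)) < \<epsilon>)))"

definition nsa_anderson :: "real \<Rightarrow> (int \<Rightarrow> complex) \<Rightarrow> (int \<Rightarrow> complex) \<Rightarrow> (int \<Rightarrow> complex)" where
  "nsa_anderson g V f = (\<lambda>m. of_real (exp (- g)) * f (m - 1) + of_real (exp g) * f (m + 1) + V m * f m)"

text \<open>
  A tuple in \<open>M\<^sup>n\<close> is a list of length \<open>n\<close> with entries in \<open>M\<close>. Matrices act on row vectors from
  the right: if \<open>nsa_anderson g V f = (\<lambda>m. z * f m)\<close>, then the row vector \<open>(f (m - 1), f m)\<close> times
  \<open>transfer_matrix g z (V m)\<close> is \<open>(f m, f (m + 1))\<close>. This is why the list is multiplied up in its own
  order.
\<close>

definition transfer_matrix :: "real \<Rightarrow> complex \<Rightarrow> complex \<Rightarrow> complex^2^2" where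
  "transfer_matrix g z a =
     vector [vector [0, - of_real (exp (- 2 * g))],
             vector [1, of_real (exp (- g)) * (z - a)]]"

definition monodromy :: "real \<Rightarrow> complex list \<Rightarrow> complex \<Rightarrow> complex^2^2" where
  "monodromy g \<alpha> z = foldr (**) (map (transfer_matrix g z) \<alpha>) (mat 1)"

definition ellipse :: "real \<Rightarrow> nat \<Rightarrow> complex set" where
  "ellipse g n = {exp (\<i> * of_real \<theta>) + exp (- 2 * of_nat n * of_real g - \<i> * of_real \<theta>) |\<theta>::real.
      - pi \<le> \<theta> \<and> \<theta> \<le> pi}"

definition I_set :: "real \<Rightarrow> complex list \<Rightarrow> complex set" where
  "I_set g \<alpha> = {z. monodromy g \<alpha> z $ 1 $ 1 + monodromy g \<alpha> z $ 2 $ 2 \<in> inside (ellipse g (length \<alpha>))}"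

definition O_set :: "real \<Rightarrow> complex list \<Rightarrow> complex set" where
  "O_set g \<alpha> = {z. monodromy g \<alpha> z $ 1 $ 1 + monodromy g \<alpha> z $ 2 $ 2 \<in> outside (ellipse g (length \<alpha>))}"

lemma l2var_attained:
  assumes "f \<noteq> (\<lambda>_. 0)"
  shows "\<exists>y. l2var f = l2moment f y"
proof (cases "\<exists>y. l2moment f y < \<infinity>")
  case False
  then have "l2moment f y = \<infinity>" for y
    by (metis infinity_ennreal_def less_top)
  then show ?thesis by (simp add: l2var_def)
next
  case True
  then obtain y0 where y0: "l2moment f y0 < \<infinity>" by blast
  from assms obtain x0 where x0: "f x0 \<noteq> 0" by blast
  define c where "c = (cmod (f x0))\<^sup>2"
  have c: "c > 0" using x0 by (simp add: c_def)
  obtain R where R: "l2moment f y0 = ennreal R" "R \<ge> 0"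
    using y0 by (cases "l2moment f y0") auto
  have lower: "ennreal ((real_of_int \<bar>x0 - y\<bar>)\<^sup>2 * c) \<le> l2moment f y" for y
  proof -
    let ?h = "\<lambda>x. ennreal ((real_of_int \<bar>x - y\<bar>)\<^sup>2 * (cmod (f x))\<^sup>2)"
    have "infsum ?h {x0} \<le> infsum ?h UNIV"
      by (rule infsum_mono_neutral) (auto intro: nonneg_summable_on_complete)
    then show ?thesis by (simp add: l2moment_def c_def)
  qed
  define S where "S = {y. l2moment f y \<le> l2moment f y0}"
  have "S \<subseteq> {x0 - \<lceil>R / c\<rceil> .. x0 + \<lceil>R / c\<rceil>}"
  proof
    fix y assume "y \<in> S"
    then have "ennreal ((real_of_int \<bar>x0 - y\<bar>)\<^sup>2 * c) \<le> ennreal R"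
      using lower[of y] R(1) by (auto simp: S_def)
    then have "(real_of_int \<bar>x0 - y\<bar>)\<^sup>2 * c \<le> R"
      using R(2) by simp
    then have "(real_of_int \<bar>x0 - y\<bar>)\<^sup>2 \<le> R / c"
      using c by (simp add: field_simps)
    moreover have "real_of_int \<bar>x0 - y\<bar> \<le> (real_of_int \<bar>x0 - y\<bar>)\<^sup>2"
    proof -
      have "\<bar>x0 - y\<bar> \<le> \<bar>x0 - y\<bar>\<^sup>2"
        by (cases "x0 = y") (simp, rule self_le_power, auto)
      then show ?thesis by (metis of_int_le_iff of_int_power)
    qed
    ultimately have "\<bar>x0 - y\<bar> \<le> \<lceil>R / c\<rceil>" by linarith
    then show "y \<in> {x0 - \<lceil>R / c\<rceil> .. x0 + \<lceil>R / c\<rceil>}" by auto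
  qed
  then have fin: "finite S" by (rule finite_subset) simp
  have ne: "y0 \<in> S" by (simp add: S_def)
  obtain y1 where y1: "y1 \<in> S" "\<And>y. y \<in> S \<Longrightarrow> l2moment f y1 \<le> l2moment f y"
    using ex_min_if_finite[of "l2moment f ` S"] fin ne
    by (metis (no_types, opaque_lifting) empty_iff finite_imageI image_iff linorder_not_le)
  have "l2moment f y1 \<le> l2moment f y" for y
    using y1 ne by (metis S_def linorder_le_cases mem_Collect_eq order_trans)
  then have "l2var f = l2moment f y1"
    unfolding l2var_def by (intro antisym INF_lower INF_greatest) auto
  then show ?thesis by blast
qed

text \<open>
  The hypothesis holds for every pseudo-ergodic \<open>V\<close> over a compact set, so \<^const>\<open>l2norm\<close> is only
  applied to members of \<^const>\<open>l2\<close> in \<^term>\<open>localized_spectrum (nsa_anderson g V)\<close>.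
\<close>

lemma nsa_anderson_bounded:
  assumes "bounded (range V)"
  shows "\<exists>C. \<forall>f\<in>l2. nsa_anderson g V f \<in> l2 \<and> l2norm (nsa_anderson g V f) \<le> C * l2norm f"
proof -
  from assms obtain B where B: "\<And>m. cmod (V m) \<le> B"
    by (auto simp: bounded_iff)
  define K where "K = max (exp \<bar>g\<bar>) B"
  have K: "K \<ge> 0" "exp g \<le> K" "exp (- g) \<le> K" "\<And>m. cmod (V m) \<le> K"
    using B by (auto simp: K_def le_max_iff_disj intro: order_trans)
  have "nsa_anderson g V f \<in> l2 \<and> l2norm (nsa_anderson g V f) \<le> 3 * K * l2norm f"
    if f: "f \<in> l2" for f
  proof -
    define q where "q = (\<lambda>m. (cmod (f m))\<^sup>2)"
    have q: "(q has_sum (l2norm f)\<^sup>2) UNIV"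
      using f by (simp add: l2_def l2norm_def q_def infsum_nonneg)
    have shift: "((\<lambda>m. q (m + k)) has_sum (l2norm f)\<^sup>2) UNIV" for k
    proof -
      have "bij (\<lambda>m. m + k)" by (rule bij_betw_byWitness[where f' = "\<lambda>m. m - k"]) auto
      then show ?thesis using q has_sum_reindex_bij_betw by blast
    qed
    define s where "s = (\<lambda>m. 3 * K\<^sup>2 * (q (m + (- 1)) + q (m + 1) + q (m + 0)))"
    have s: "(s has_sum (3 * K\<^sup>2 * ((l2norm f)\<^sup>2 + (l2norm f)\<^sup>2 + (l2norm f)\<^sup>2))) UNIV"
      unfolding s_def by (intro has_sum_cmult_right has_sum_add shift)
    have le: "(cmod (nsa_anderson g V f m))\<^sup>2 \<le> s m" for m
    proof -
      define a b c where "a = cmod (f (m - 1))" and "b = cmod (f (m + 1))" and "c = cmod (f m)"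
      have "cmod (nsa_anderson g V f m) \<le> exp (- g) * a + exp g * b + cmod (V m) * c"
        unfolding nsa_anderson_def a_def b_def c_def
        by (rule order_trans[OF norm_triangle_ineq] add_mono norm_triangle_le)+
           (auto simp: norm_mult)
      also have "\<dots> \<le> K * a + K * b + K * c"
        using K by (intro add_mono mult_right_mono) (auto simp: a_def b_def c_def)
      finally have "(cmod (nsa_anderson g V f m))\<^sup>2 \<le> (K * (a + b + c))\<^sup>2"
        by (intro power_mono) (auto simp: algebra_simps)
      also have "\<dots> = K\<^sup>2 * (a + b + c)\<^sup>2" by (simp add: power_mult_distrib)
      also have "\<dots> \<le> K\<^sup>2 * (3 * (a\<^sup>2 + b\<^sup>2 + c\<^sup>2))"
      proof (rule mult_left_mono)
        have "0 \<le> (a - b)\<^sup>2 + (b - c)\<^sup>2 + (a - c)\<^sup>2" by simp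
        then show "(a + b + c)\<^sup>2 \<le> 3 * (a\<^sup>2 + b\<^sup>2 + c\<^sup>2)"
          by (simp add: power2_eq_square algebra_simps)
      qed simp
      finally show ?thesis by (simp add: s_def q_def a_def b_def c_def algebra_simps)
    qed
    have sm: "(\<lambda>m. (cmod (nsa_anderson g V f m))\<^sup>2) summable_on UNIV"
      by (rule summable_on_comparison_test[OF has_sum_imp_summable[OF s]]) (use le in auto)
    have "(\<Sum>\<^sub>\<infinity>m. (cmod (nsa_anderson g V f m))\<^sup>2) \<le> infsum s UNIV"
      by (rule infsum_mono[OF sm has_sum_imp_summable[OF s]]) (use le in auto)
    also have "\<dots> = (3 * K * l2norm f)\<^sup>2"
      using infsumI[OF s] by (simp add: power2_eq_square algebra_simps)
    finally have "l2norm (nsa_anderson g V f) \<le> sqrt ((3 * K * l2norm f)\<^sup>2)"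
      unfolding l2norm_def by (rule real_sqrt_le_mono)
    moreover have "l2norm f \<ge> 0" by (simp add: l2norm_def infsum_nonneg)
    ultimately show ?thesis using sm K(1) by (simp add: l2_def)
  qed
  then show ?thesis by blast
qed

end

theory Submission
  imports Defs
begin

text \<open>
  Fix \<open>z\<close> in \<open>I_set g \<alpha> \<inter> O_set g \<beta>\<close> and let \<open>W\<close> be the potential that repeats \<open>\<alpha>\<close> periodically on
  the non-negative integers and \<open>\<beta>\<close> on the negative ones. The operator with potential \<open>W\<close> has \<open>z\<close>
  as an eigenvalue with an exponentially decaying eigenfunction, and pseudo-ergodicity copies
  arbitrarily long pieces of that eigenfunction into the operator with potential \<open>V\<close>.

  The eigenvalues \<open>\<mu>\<close>, \<open>\<nu>\<close> of the monodromy matrix of a word of length \<open>n\<close> have product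
  \<open>q = exp (- 2 n g) < 1\<close>, and the ellipse consists of the traces \<open>\<mu> + q / \<mu>\<close> with \<open>\<bar>\<mu>\<bar> = 1\<close>. A
  trace inside the ellipse means that both eigenvalues lie in the open unit disc
  (\<open>inside_ellipse_roots\<close>); a trace outside means that one eigenvalue has modulus greater than 1
  (\<open>outside_ellipse_root\<close>). Hence every solution for the word \<open>\<alpha>\<close> decays to the right
  (\<open>I_set_solutions_decay\<close>), while the solution for \<open>\<beta>\<close> that starts at the left eigenvector of the
  large eigenvalue decays to the left (\<open>O_set_growing_solution\<close>). As \<^emph>\<open>all\<close> solutions decay on the
  right, the one on the left can be continued across the origin without any matching condition
  (\<open>decaying_solution_exists\<close>).

  Cutting this eigenfunction off at distance \<open>N\<close> and moving it to a place where \<open>V\<close> agrees with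
  \<open>W\<close> up to \<open>\<rho>\<^sup>N\<close>, where \<open>\<rho>\<close> is the rate of decay, gives an error of order at most \<open>N \<rho>\<^sup>N\<close>. The variances
  stay bounded because the eigenfunction has a finite second moment
  (\<open>localized_spectrum_of_decaying_solution\<close>).
\<close>

section \<open>The ellipse and the roots of a quadratic polynomial\<close>

text \<open>
  For \<open>q = exp (- 2 n g)\<close> the ellipse has semi-axes \<open>1 + q\<close> and \<open>1 - q\<close>; dividing by them turns it
  into the unit circle.
\<close>

definition ellipse_scale :: "real \<Rightarrow> complex \<Rightarrow> complex" where
  "ellipse_scale q w = Complex (Re w / (1 + q)) (Im w / (1 - q))"

lemma linear_ellipse_scale: "linear (ellipse_scale q)"
  by (rule linearI) (auto simp: ellipse_scale_def complex_eq_iff add_divide_distrib)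

lemma continuous_on_ellipse_scale: "continuous_on A (ellipse_scale q)"
  by (rule linear_continuous_on) (use linear_ellipse_scale linear_conv_bounded_linear in blast)

lemma ellipse_scale_polar:
  assumes "s > 0"
  shows "ellipse_scale q (of_real s * cis \<theta> + of_real (q / s) * cis (- \<theta>)) =
    Complex ((s + q / s) / (1 + q) * cos \<theta>) ((s - q / s) / (1 - q) * sin \<theta>)"
  by (simp add: ellipse_scale_def complex_eq_iff algebra_simps diff_divide_distrib add_divide_distrib)

lemma ellipse_eq_vimage_sphere:
  assumes "g > 0" "n \<ge> 1"
  defines "q \<equiv> exp (- 2 * real n * g)"
  shows "ellipse g n = ellipse_scale q -` sphere 0 1"
proof -
  have q: "0 < q" "q < 1" using assms by (auto simp: q_def)
  have param: "exp (\<i> * of_real \<theta>) + exp (- 2 * of_nat n * of_real g - \<i> * of_real \<theta>)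
      = of_real 1 * cis \<theta> + of_real (q / 1) * cis (- \<theta>)" for \<theta> :: real
  proof -
    have "exp (- 2 * of_nat n * of_real g - \<i> * of_real \<theta>)
        = exp (of_real (- 2 * real n * g)) * exp (\<i> * of_real (- \<theta>))"
      by (simp add: exp_add [symmetric])
    then show ?thesis by (simp add: q_def cis_conv_exp flip: exp_of_real)
  qed
  have scale: "ellipse_scale q (of_real 1 * cis \<theta> + of_real (q / 1) * cis (- \<theta>)) = cis \<theta>" for \<theta>
    using ellipse_scale_polar[of 1 q \<theta>] q by (simp add: complex_eq_iff)
  have inj: "w = w'" if "ellipse_scale q w = ellipse_scale q w'" for w w'
    using that q by (simp add: ellipse_scale_def complex_eq_iff)
  show ?thesis
  proof (intro equalityI subsetI)
    fix w assume "w \<in> ellipse g n"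
    then show "w \<in> ellipse_scale q -` sphere 0 1"
      unfolding ellipse_def param by (auto simp only: scale) (use scale in auto)
  next
    fix w assume "w \<in> ellipse_scale q -` sphere 0 1"
    then have "cmod (ellipse_scale q w) = 1" by simp
    then have polar: "cis (Arg (ellipse_scale q w)) = ellipse_scale q w"
      by (metis cis_Arg div_by_1 norm_zero of_real_1 sgn_eq zero_neq_one)
    have "w = of_real 1 * cis (Arg (ellipse_scale q w)) + of_real (q / 1) * cis (- Arg (ellipse_scale q w))"
      by (rule inj, subst scale) (rule polar [symmetric])
    then show "w \<in> ellipse g n"
      unfolding ellipse_def param using Arg_bounded[of "ellipse_scale q w"] by fastforce
  qed
qed

text \<open>
  The topological inside and outside are reduced to an inequality by convexity: the complement of a
  convex set containing the ellipse lies outside it, and the outside of the frontier of a bounded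
  set misses that set.
\<close>

lemma inside_ellipse_scale:
  assumes "g > 0" "n \<ge> 1" "w \<in> inside (ellipse g n)"
  shows "cmod (ellipse_scale (exp (- 2 * real n * g)) w) < 1"
proof (rule ccontr)
  define L where "L = ellipse_scale (exp (- 2 * real n * g))"
  have E: "ellipse g n = L -` sphere 0 1"
    unfolding L_def using ellipse_eq_vimage_sphere assms by blast
  assume "\<not> ?thesis"
  moreover have "w \<notin> ellipse g n"
    using assms(3) inside_no_overlap by blast
  then have "cmod (L w) \<noteq> 1" by (simp add: E)
  ultimately have "w \<in> - (L -` cball 0 1)" by (simp add: L_def)
  moreover have "convex (L -` cball 0 1)"
    unfolding L_def by (intro convex_linear_vimage linear_ellipse_scale convex_cball)
  moreover have "ellipse g n \<subseteq> L -` cball 0 1" by (auto simp: E)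
  ultimately have "w \<in> outside (ellipse g n)"
    using outside_subset_convex by blast
  then show False using assms(3) inside_Int_outside by blast
qed

lemma outside_ellipse_scale:
  assumes "g > 0" "n \<ge> 1" "w \<in> outside (ellipse g n)"
  shows "cmod (ellipse_scale (exp (- 2 * real n * g)) w) > 1"
proof -
  define q where "q = exp (- 2 * real n * g)"
  define L where "L = ellipse_scale q"
  define S where "S = L -` ball 0 1"
  have q: "0 < q" "q < 1" using assms by (auto simp: q_def)
  have E: "ellipse g n = L -` sphere 0 1"
    unfolding L_def q_def using ellipse_eq_vimage_sphere assms by blast
  have "bounded S"
  proof (rule boundedI)
    fix w assume "w \<in> S"
    then have "cmod (L w) < 1" by (simp add: S_def)
    then have "\<bar>Re (L w)\<bar> < 1" "\<bar>Im (L w)\<bar> < 1"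
      using abs_Re_le_cmod abs_Im_le_cmod by (meson le_less_trans)+
    then have "\<bar>Re w\<bar> \<le> 1 + q" "\<bar>Im w\<bar> \<le> 1 - q"
      using q by (auto simp: L_def ellipse_scale_def abs_divide divide_simps)
    then show "cmod w \<le> 2" using cmod_le[of w] by linarith
  qed
  have "open S" "closed (L -` cball 0 1)"
    using continuous_on_ellipse_scale[of UNIV q]
    by (auto simp: S_def L_def intro: open_vimage closed_vimage)
  moreover have "S \<subseteq> L -` cball 0 1" by (auto simp: S_def)
  ultimately have "frontier S \<subseteq> L -` cball 0 1 - S"
    using closure_minimal[of S "L -` cball 0 1"] by (auto simp: frontier_def interior_open)
  then have "frontier S \<subseteq> ellipse g n" by (auto simp: S_def E)
  then have "outside (ellipse g n) \<subseteq> - closure S"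
    using outside_mono outside_frontier_misses_closure[OF \<open>bounded S\<close>] by blast
  then have "w \<notin> S" using assms(3) closure_subset[of S] by blast
  then have "cmod (L w) \<ge> 1" by (simp add: S_def)
  moreover have "w \<notin> ellipse g n"
    using assms(3) outside_no_overlap by blast
  then have "cmod (L w) \<noteq> 1" by (simp add: E)
  ultimately show ?thesis by (simp add: L_def q_def)
qed

lemma cmod_mult_components_le:
  assumes "\<bar>A\<bar> \<le> c" "\<bar>B\<bar> \<le> c"
  shows "cmod (Complex (A * cos \<theta>) (B * sin \<theta>)) \<le> c"
proof -
  have "(A * cos \<theta>)\<^sup>2 + (B * sin \<theta>)\<^sup>2 \<le> c\<^sup>2 * (cos \<theta>)\<^sup>2 + c\<^sup>2 * (sin \<theta>)\<^sup>2"
    unfolding power_mult_distrib using assms by (intro add_mono mult_right_mono abs_le_square_iff[THEN iffD1]) auto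
  also have "\<dots> = c\<^sup>2" by (simp flip: distrib_left)
  finally show ?thesis using assms by (simp add: cmod_def real_le_lsqrt)
qed

lemma cmod_mult_components_ge:
  assumes "A \<ge> 1" "B \<ge> 1"
  shows "cmod (Complex (A * cos \<theta>) (B * sin \<theta>)) \<ge> 1"
proof -
  have "1 = 1 * (cos \<theta>)\<^sup>2 + 1 * (sin \<theta>)\<^sup>2" by simp
  also have "\<dots> \<le> (A * cos \<theta>)\<^sup>2 + (B * sin \<theta>)\<^sup>2"
    unfolding power_mult_distrib using assms by (intro add_mono mult_right_mono one_le_power) auto
  finally show ?thesis by (simp add: cmod_def)
qed

text \<open>
  A root of modulus \<open>s\<close> puts the sum of the roots on the ellipse with semi-axes \<open>s + q / s\<close> and
  \<open>\<bar>s - q / s\<bar>\<close>, confocal to the case \<open>s = 1\<close>. Comparing semi-axes decides on which side of the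
  original ellipse the sum lies.
\<close>

lemma root_sum_polar:
  assumes "\<mu> * \<nu> = of_real q" "\<mu> \<noteq> 0"
  shows "\<mu> + \<nu> = of_real (cmod \<mu>) * cis (Arg \<mu>) + of_real (q / cmod \<mu>) * cis (- Arg \<mu>)"
proof -
  have \<mu>: "\<mu> = of_real (cmod \<mu>) * cis (Arg \<mu>)"
    using rcis_cmod_Arg[of \<mu>] by (simp add: rcis_def)
  have "\<nu> = of_real q / \<mu>" using assms by (simp add: field_simps)
  also have "\<dots> = of_real q / (of_real (cmod \<mu>) * cis (Arg \<mu>))" using \<mu> by simp
  also have "\<dots> = of_real (q / cmod \<mu>) * cis (- Arg \<mu>)"
    by (simp add: divide_inverse)
  finally show ?thesis using \<mu> by simp
qed

lemma inside_ellipse_roots: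
  assumes "g > 0" "n \<ge> 1" "\<mu> + \<nu> \<in> inside (ellipse g n)"
    and \<mu>\<nu>: "\<mu> * \<nu> = of_real (exp (- 2 * real n * g))"
  shows "cmod \<mu> < 1"
proof (rule ccontr)
  assume "\<not> ?thesis"
  then have s1: "cmod \<mu> \<ge> 1" by simp
  define q s where "q = exp (- 2 * real n * g)" and "s = cmod \<mu>"
  have q: "0 < q" "q < 1" using assms by (auto simp: q_def)
  have s: "s \<ge> 1" using s1 by (simp add: s_def)
  \<comment> \<open>Both semi-axes for modulus \<open>s\<close> are at least those of the given ellipse.\<close>
  have "0 \<le> (s - 1) * (s - q)" "0 \<le> (s - 1) * (s + q)"
    using s q by (auto intro!: mult_nonneg_nonneg)
  then have "s * (1 + q) \<le> s * s + q" "s * (1 - q) \<le> s * s - q"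
    by (auto simp: algebra_simps)
  then have "1 + q \<le> s + q / s" "1 - q \<le> s - q / s"
    using s by (simp_all add: field_simps)
  then have "(s + q / s) / (1 + q) \<ge> 1" "(s - q / s) / (1 - q) \<ge> 1"
    using q by simp_all
  then have "1 \<le> cmod (Complex ((s + q / s) / (1 + q) * cos (Arg \<mu>)) ((s - q / s) / (1 - q) * sin (Arg \<mu>)))"
    by (rule cmod_mult_components_ge)
  also have "\<dots> = cmod (ellipse_scale q (\<mu> + \<nu>))"
  proof -
    have "\<mu> + \<nu> = of_real s * cis (Arg \<mu>) + of_real (q / s) * cis (- Arg \<mu>)"
      using root_sum_polar[of \<mu> \<nu> q] \<mu>\<nu> s1 unfolding q_def s_def by fastforce
    then show ?thesis using ellipse_scale_polar[of s q "Arg \<mu>"] s by simp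
  qed
  finally show False using inside_ellipse_scale[OF assms(1-3)] by (simp add: q_def)
qed

lemma roots_of_sum_and_product:
  fixes t d :: complex
  obtains \<mu> \<nu> where "\<mu> + \<nu> = t" "\<mu> * \<nu> = d"
proof
  let ?r = "csqrt (t\<^sup>2 - 4 * d)"
  show "(t + ?r) / 2 + (t - ?r) / 2 = t" by (simp add: field_simps)
  have "(t + ?r) * (t - ?r) = t\<^sup>2 - ?r\<^sup>2" by (simp add: power2_eq_square algebra_simps)
  also have "\<dots> = 4 * d" by simp
  finally show "(t + ?r) / 2 * ((t - ?r) / 2) = d" by simp
qed

lemma outside_ellipse_root:
  assumes "g > 0" "n \<ge> 1" "t \<in> outside (ellipse g n)"
  obtains \<mu> \<nu> where "\<mu> + \<nu> = t" "\<mu> * \<nu> = of_real (exp (- 2 * real n * g))" "cmod \<mu> > 1"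
proof -
  define q where "q = exp (- 2 * real n * g)"
  have q: "0 < q" "q < 1" using assms by (auto simp: q_def)
  obtain \<mu> \<nu> where \<mu>\<nu>: "\<mu> + \<nu> = t" "\<mu> * \<nu> = of_real q"
    using roots_of_sum_and_product by blast
  have "cmod \<mu> > 1 \<or> cmod \<nu> > 1"
  proof (rule ccontr)
    assume "\<not> ?thesis"
    then have le1: "cmod \<mu> \<le> 1" "cmod \<nu> \<le> 1" by auto
    define s where "s = cmod \<mu>"
    have "s * cmod \<nu> = q"
      using \<mu>\<nu>(2) q unfolding s_def by (metis norm_mult norm_of_real abs_of_pos)
    then have s: "q \<le> s" "s \<le> 1"
      using le1 mult_left_le[of "cmod \<nu>" s] by (auto simp: s_def)
    have s0: "s > 0" using s q by simp
    \<comment> \<open>Both semi-axes for modulus \<open>s\<close> are at most those of the given ellipse.\<close>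
    have "0 \<le> (1 - s) * (s - q)" "0 \<le> (1 - s) * (s + q)" "0 \<le> (s - q) * (1 + s)"
      using s q by (auto intro!: mult_nonneg_nonneg)
    then have "s * s + q \<le> s * (1 + q)" "s * s - q \<le> s * (1 - q)" "q - s * s \<le> s * (1 - q)"
      by (auto simp: algebra_simps)
    then have "s + q / s \<le> 1 + q" "s - q / s \<le> 1 - q" "q / s - s \<le> 1 - q" "0 \<le> s + q / s"
      using s0 q by (simp_all add: field_simps)
    then have "\<bar>(s + q / s) / (1 + q)\<bar> \<le> 1" "\<bar>(s - q / s) / (1 - q)\<bar> \<le> 1"
      using q by (auto simp: abs_divide)
    then have "cmod (Complex ((s + q / s) / (1 + q) * cos (Arg \<mu>)) ((s - q / s) / (1 - q) * sin (Arg \<mu>))) \<le> 1"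
      by (rule cmod_mult_components_le)
    also have "Complex ((s + q / s) / (1 + q) * cos (Arg \<mu>)) ((s - q / s) / (1 - q) * sin (Arg \<mu>)) = ellipse_scale q t"
    proof -
      have "\<mu> + \<nu> = of_real s * cis (Arg \<mu>) + of_real (q / s) * cis (- Arg \<mu>)"
        using root_sum_polar[of \<mu> \<nu> q] \<mu>\<nu> s0 unfolding s_def by fastforce
      then show ?thesis using ellipse_scale_polar[of s q "Arg \<mu>"] s0 \<mu>\<nu> by simp
    qed
    finally show False using outside_ellipse_scale[OF assms] by (simp add: q_def)
  qed
  then show thesis
  proof
    assume "cmod \<mu> > 1"
    with \<mu>\<nu> show thesis unfolding q_def by (rule that)
  next
    assume "cmod \<nu> > 1"
    with \<mu>\<nu> show thesis unfolding q_def by (intro that[of \<nu> \<mu>]) (auto simp: add.commute mult.commute)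
  qed
qed

section \<open>Solutions on a half line\<close>

text \<open>
  The eigenvalue equation on a half line, solved for the newest value. Index 0 stands for the site
  \<open>- 1\<close>: the equation at site \<open>m\<close> involves the entries \<open>m\<close>, \<open>m + 1\<close> and \<open>m + 2\<close> and the potential
  \<open>W m\<close>, so that the row vector \<open>(u m, u (m + 1))\<close> is what the transfer matrix of \<open>W m\<close> acts on.
\<close>

definition half_line_solution :: "real \<Rightarrow> complex \<Rightarrow> (nat \<Rightarrow> complex) \<Rightarrow> (nat \<Rightarrow> complex) \<Rightarrow> bool" where
  "half_line_solution g z W u \<longleftrightarrow>
     (\<forall>m. u (Suc (Suc m)) = - of_real (exp (- 2 * g)) * u m + of_real (exp (- g)) * (z - W m) * u (Suc m))"

lemma half_line_solution_exists: "\<exists>u. half_line_solution g z W u \<and> u 0 = a \<and> u 1 = b"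
proof -
  define P where "P = rec_nat (a, b) (\<lambda>m (x, y). (y, - of_real (exp (- 2 * g)) * x + of_real (exp (- g)) * (z - W m) * y))"
  have "P (Suc m) = (snd (P m), - of_real (exp (- 2 * g)) * fst (P m) + of_real (exp (- g)) * (z - W m) * snd (P m))" for m
    by (simp add: P_def case_prod_unfold)
  moreover have "P 0 = (a, b)" by (simp add: P_def)
  ultimately have "half_line_solution g z W (\<lambda>m. fst (P m)) \<and> fst (P 0) = a \<and> fst (P 1) = b"
    by (simp add: half_line_solution_def)
  then show ?thesis by blast
qed

lemma half_line_solution_zero:
  assumes "half_line_solution g z W u" "u 0 = 0" "u 1 = 0"
  shows "u m = 0"
proof -
  have "u m = 0 \<and> u (Suc m) = 0"
    using assms by (induction m) (auto simp: half_line_solution_def)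
  then show ?thesis ..
qed

lemma half_line_solution_shift:
  assumes "half_line_solution g z W u" "\<And>m. W (m + n) = W m"
  shows "half_line_solution g z W (\<lambda>m. u (m + n))"
  using assms by (auto simp: half_line_solution_def)

lemma half_line_solution_lincomb:
  assumes "half_line_solution g z W u" "half_line_solution g z W v"
  shows "half_line_solution g z W (\<lambda>m. c * u m + d * v m)"
  unfolding half_line_solution_def
proof
  fix m
  let ?p = "- of_real (exp (- 2 * g)) :: complex" and ?r = "of_real (exp (- g)) * (z - W m)"
  have "u (Suc (Suc m)) = ?p * u m + ?r * u (Suc m)" "v (Suc (Suc m)) = ?p * v m + ?r * v (Suc m)"
    using assms by (simp_all add: half_line_solution_def)
  then show "c * u (Suc (Suc m)) + d * v (Suc (Suc m)) = ?p * (c * u m + d * v m) + ?r * (c * u (Suc m) + d * v (Suc m))"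
    by algebra
qed

lemma monodromy_Cons: "monodromy g (a # as) z = transfer_matrix g z a ** monodromy g as z"
  by (simp add: monodromy_def)

lemma det_monodromy: "det (monodromy g as z) = of_real (exp (- 2 * real (length as) * g))"
proof (induction as)
  case Nil
  then show ?case by (simp add: monodromy_def)
next
  case (Cons a as)
  have "det (transfer_matrix g z a) = of_real (exp (- 2 * g))"
    by (simp add: det_2 transfer_matrix_def)
  then show ?case using Cons by (simp add: monodromy_Cons det_mul algebra_simps flip: of_real_mult exp_add)
qed

lemma half_line_solution_monodromy:
  assumes u: "half_line_solution g z W u"
  shows "vector [u m, u (Suc m)] v* monodromy g (map W [m..<m + k]) z
    = (vector [u (m + k), u (Suc (m + k))] :: complex^2)"
proof (induction k arbitrary: m)
  case 0
  then show ?case by (simp add: monodromy_def)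
next
  case (Suc k)
  have step: "vector [u m, u (Suc m)] v* transfer_matrix g z (W m) = (vector [u (Suc m), u (Suc (Suc m))] :: complex^2)"
    using u by (simp add: vec_eq_iff forall_2 vector_matrix_mult_def sum_2 transfer_matrix_def half_line_solution_def algebra_simps)
  have "[m..<m + Suc k] = m # [Suc m..<Suc m + k]" by (simp add: upt_conv_Cons)
  then have "vector [u m, u (Suc m)] v* monodromy g (map W [m..<m + Suc k]) z
      = (vector [u m, u (Suc m)] v* transfer_matrix g z (W m)) v* monodromy g (map W [Suc m..<Suc m + k]) z"
    by (simp add: monodromy_Cons vector_matrix_mul_assoc)
  also have "\<dots> = vector [u (m + Suc k), u (Suc (m + Suc k))]"
    unfolding step Suc by simp
  finally show ?case .
qed

lemma map_periodic_upt:
  assumes "as \<noteq> []"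
  shows "map (\<lambda>m. as ! (m mod length as)) [k * length as..<k * length as + length as] = as"
  by (rule nth_equalityI) auto

lemma periodic_solution_monodromy:
  fixes as :: "complex list"
  defines "n \<equiv> length as"
  assumes u: "half_line_solution g z (\<lambda>m. as ! (m mod n)) u" and "as \<noteq> []"
  shows "u (k * n + n) = u (k * n) * monodromy g as z $ 1 $ 1 + u (Suc (k * n)) * monodromy g as z $ 2 $ 1"
    and "u (Suc (k * n + n)) = u (k * n) * monodromy g as z $ 1 $ 2 + u (Suc (k * n)) * monodromy g as z $ 2 $ 2"
proof -
  have "vector [u (k * n), u (Suc (k * n))] v* monodromy g as z
      = (vector [u (k * n + n), u (Suc (k * n + n))] :: complex^2)"
    using half_line_solution_monodromy[OF u, of "k * n" n] map_periodic_upt[OF \<open>as \<noteq> []\<close>] by (simp add: n_def)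
  then show "u (k * n + n) = u (k * n) * monodromy g as z $ 1 $ 1 + u (Suc (k * n)) * monodromy g as z $ 2 $ 1"
    and "u (Suc (k * n + n)) = u (k * n) * monodromy g as z $ 1 $ 2 + u (Suc (k * n)) * monodromy g as z $ 2 $ 2"
    by (auto simp: vec_eq_iff forall_2 vector_matrix_mult_def sum_2 algebra_simps)
qed

text \<open>
  This is Cayley-Hamilton for the monodromy matrix \<open>B\<close>, in the form that shifting by a period has
  characteristic polynomial \<open>(X - \<mu>) (X - \<nu>)\<close> on solutions. The matrix identity gives it at the
  first two indices only; since the difference of both sides is again a solution, it then holds
  everywhere, and powers of \<open>B\<close> never have to be estimated.
\<close>

lemma periodic_solution_recurrence:
  fixes as :: "complex list"
  defines "n \<equiv> length as"
  assumes u: "half_line_solution g z (\<lambda>m. as ! (m mod n)) u" and "as \<noteq> []"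
    and sum: "\<mu> + \<nu> = monodromy g as z $ 1 $ 1 + monodromy g as z $ 2 $ 2"
    and prod: "\<mu> * \<nu> = of_real (exp (- 2 * real n * g))"
  shows "u (m + n + n) - \<mu> * u (m + n) = \<nu> * (u (m + n) - \<mu> * u m)"
proof -
  define B where "B = monodromy g as z"
  define W where "W = (\<lambda>m. as ! (m mod n))"
  define w where "w = (\<lambda>m. 1 * u (m + n + n) + 1 * ((- (\<mu> + \<nu>)) * u (m + n) + (\<mu> * \<nu>) * u m))"
  note u' = u [folded W_def]
  note step = half_line_solution_shift[where n = n and W = W]
  have W: "W (m + n) = W m" for m by (simp add: W_def)
  have "half_line_solution g z W (\<lambda>m. u (m + n))" by (rule step) (use u' W in auto)
  moreover from this have "half_line_solution g z W (\<lambda>m. u (m + n + n))" by (rule step) (use W in auto)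
  ultimately have w: "half_line_solution g z W w"
    unfolding w_def using u' by (intro half_line_solution_lincomb)
  have \<mu>\<nu>: "\<mu> + \<nu> = B $ 1 $ 1 + B $ 2 $ 2" "\<mu> * \<nu> = B $ 1 $ 1 * B $ 2 $ 2 - B $ 1 $ 2 * B $ 2 $ 1"
    using sum prod det_monodromy[of g as z] by (auto simp: B_def n_def det_2)
  note B0 = periodic_solution_monodromy[OF u [unfolded n_def] \<open>as \<noteq> []\<close>, of 0, folded n_def B_def, simplified]
  note B1 = periodic_solution_monodromy[OF u [unfolded n_def] \<open>as \<noteq> []\<close>, of 1, folded n_def B_def, simplified]
  have "w 0 = 0" "w 1 = 0"
    unfolding w_def \<mu>\<nu> by (simp_all add: B0 B1) algebra+
  then have "w m = 0" using half_line_solution_zero w by blast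
  then show ?thesis by (simp add: w_def algebra_simps)
qed

text \<open>
  The constant \<open>C\<close> must dominate the first \<open>n\<close> terms and satisfy \<open>\<bar>\<mu>\<bar> C + D \<le> C \<rho>\<^sup>n\<close>, which the
  strict inequality \<open>\<bar>\<mu>\<bar> < \<rho>\<^sup>n\<close> makes possible; induction does the rest. Allowing an error term
  lets the factors \<open>X - \<nu>\<close> and \<open>X - \<mu>\<close> in \<open>periodic_solution_recurrence\<close> be removed one after the
  other, without a case distinction for a double root.
\<close>

lemma geometric_decay_of_recurrence:
  fixes x :: "nat \<Rightarrow> complex"
  assumes "n \<ge> 1" "\<rho> > 0" "cmod \<mu> < \<rho> ^ n"
    and rec: "\<And>m. cmod (x (m + n) - \<mu> * x m) \<le> D * \<rho> ^ m"
  shows "\<exists>C. \<forall>m. cmod (x m) \<le> C * \<rho> ^ m"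
proof -
  define C where "C = Max (insert (D / (\<rho> ^ n - cmod \<mu>)) ((\<lambda>m. cmod (x m) / \<rho> ^ m) ` {..<n}))"
  have C: "cmod (x m) / \<rho> ^ m \<le> C" if "m < n" for m
    unfolding C_def using that by (intro Max_ge) auto
  have "D / (\<rho> ^ n - cmod \<mu>) \<le> C" unfolding C_def by (intro Max_ge) auto
  then have D: "cmod \<mu> * C + D \<le> C * \<rho> ^ n" using assms by (simp add: field_simps)
  have "cmod (x m) \<le> C * \<rho> ^ m" for m
  proof (induction m rule: less_induct)
    case (less m)
    show ?case
    proof (cases "m < n")
      case True
      then show ?thesis using C[OF True] \<open>\<rho> > 0\<close> by (simp add: field_simps)
    next
      case False
      define k where "k = m - n"
      have m: "m = k + n" using False by (simp add: k_def)
      have "cmod (x m) \<le> cmod \<mu> * cmod (x k) + cmod (x (k + n) - \<mu> * x k)"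
        unfolding m norm_mult [symmetric] by (metis add.commute diff_add_cancel norm_triangle_ineq)
      also have "\<dots> \<le> cmod \<mu> * (C * \<rho> ^ k) + D * \<rho> ^ k"
        using less[of k] m \<open>n \<ge> 1\<close> rec[of k] by (intro add_mono mult_left_mono) auto
      also have "\<dots> = (cmod \<mu> * C + D) * \<rho> ^ k" by (simp add: algebra_simps)
      also have "\<dots> \<le> C * \<rho> ^ n * \<rho> ^ k"
        using D \<open>\<rho> > 0\<close> by (intro mult_right_mono) auto
      finally show ?thesis by (simp add: m power_add mult_ac)
    qed
  qed
  then show ?thesis by blast
qed

lemma obtain_root_above:
  fixes s :: real
  assumes "s < 1" "n \<ge> 1"
  obtains \<rho> where "0 < \<rho>" "\<rho> < 1" "s < \<rho> ^ n"
proof -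
  define r where "r = (max s 0 + 1) / 2"
  have r: "0 < r" "r < 1" "s < r" using assms by (auto simp: r_def)
  show thesis
    by (rule that[of "root n r"]) (use r assms in auto)
qed

text \<open>
  Since \<open>B - \<mu>\<close> is singular, each row of its adjugate is a left eigenvector unless it vanishes; both
  rows vanish only if \<open>B\<close> is the scalar matrix \<open>\<mu>\<close>.
\<close>

lemma left_eigenvector_2:
  fixes B :: "complex^2^2"
  assumes "\<mu> + \<nu> = B $ 1 $ 1 + B $ 2 $ 2" "\<mu> * \<nu> = det B"
  obtains x y where "x \<noteq> 0 \<or> y \<noteq> 0"
    "x * B $ 1 $ 1 + y * B $ 2 $ 1 = \<mu> * x" "x * B $ 1 $ 2 + y * B $ 2 $ 2 = \<mu> * y"
proof -
  have char: "(B $ 1 $ 1 - \<mu>) * (B $ 2 $ 2 - \<mu>) = B $ 1 $ 2 * B $ 2 $ 1"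
    using assms unfolding det_2 by algebra
  consider "B $ 2 $ 1 \<noteq> 0 \<or> \<mu> - B $ 1 $ 1 \<noteq> 0" | "\<mu> - B $ 2 $ 2 \<noteq> 0 \<or> B $ 1 $ 2 \<noteq> 0"
    | "B $ 2 $ 1 = 0" "\<mu> = B $ 1 $ 1" "B $ 1 $ 2 = 0" by auto
  then show thesis
  proof cases
    case 1
    show ?thesis
    proof (rule that[OF 1])
      show "B $ 2 $ 1 * B $ 1 $ 2 + (\<mu> - B $ 1 $ 1) * B $ 2 $ 2 = \<mu> * (\<mu> - B $ 1 $ 1)"
        using char by algebra
    qed (simp add: algebra_simps)
  next
    case 2
    show ?thesis
    proof (rule that[OF 2])
      show "(\<mu> - B $ 2 $ 2) * B $ 1 $ 1 + B $ 1 $ 2 * B $ 2 $ 1 = \<mu> * (\<mu> - B $ 2 $ 2)"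
        using char by algebra
    qed (simp add: algebra_simps)
  next
    case 3
    show ?thesis by (rule that[of 1 0]) (use 3 in auto)
  qed
qed

section \<open>Transplanting a decaying eigenfunction\<close>

lemma finite_support_l2norm:
  assumes "finite S" "\<And>x. x \<notin> S \<Longrightarrow> f x = 0"
  shows "f \<in> l2" "l2norm f = sqrt (\<Sum>x\<in>S. (cmod (f x))\<^sup>2)"
proof -
  have "(\<lambda>x. (cmod (f x))\<^sup>2) summable_on S" using assms(1) by (rule summable_on_finite)
  moreover have "(\<lambda>x. (cmod (f x))\<^sup>2) summable_on UNIV \<longleftrightarrow> (\<lambda>x. (cmod (f x))\<^sup>2) summable_on S"
    using assms(2) by (intro summable_on_cong_neutral) auto
  ultimately show "f \<in> l2" by (simp add: l2_def)
  have "infsum (\<lambda>x. (cmod (f x))\<^sup>2) UNIV = infsum (\<lambda>x. (cmod (f x))\<^sup>2) S"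
    using assms(2) by (intro infsum_cong_neutral) auto
  then show "l2norm f = sqrt (\<Sum>x\<in>S. (cmod (f x))\<^sup>2)"
    using assms(1) by (simp add: l2norm_def)
qed

lemma finite_support_l2moment:
  assumes "finite S" "\<And>x. x \<notin> S \<Longrightarrow> f x = 0"
  shows "l2moment f y = ennreal (\<Sum>x\<in>S. (real_of_int \<bar>x - y\<bar>)\<^sup>2 * (cmod (f x))\<^sup>2)"
proof -
  have "l2moment f y = infsum (\<lambda>x. ennreal ((real_of_int \<bar>x - y\<bar>)\<^sup>2 * (cmod (f x))\<^sup>2)) S"
    unfolding l2moment_def using assms(2) by (intro infsum_cong_neutral) auto
  then show ?thesis using assms(1) by (simp add: sum_ennreal)
qed

lemma sum_symmetric_interval_le:
  fixes w :: "nat \<Rightarrow> real"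
  assumes "\<And>k. 0 \<le> w k"
  shows "(\<Sum>m\<in>{- int N..int N}. w (nat \<bar>m\<bar>)) \<le> 2 * (\<Sum>k<Suc N. w k)"
proof (induction N)
  case 0
  then show ?case using assms[of 0] by simp
next
  case (Suc N)
  have "{- int (Suc N)..int (Suc N)} = insert (- int (Suc N)) (insert (int (Suc N)) {- int N..int N})"
    by auto
  then have "(\<Sum>m\<in>{- int (Suc N)..int (Suc N)}. w (nat \<bar>m\<bar>))
      = 2 * w (Suc N) + (\<Sum>m\<in>{- int N..int N}. w (nat \<bar>m\<bar>))"
    by (simp add: nat_add_distrib)
  then show ?case using Suc by simp
qed

lemma summable_second_moment_geometric:
  fixes \<rho> :: real
  assumes "0 < \<rho>" "\<rho> < 1"
  shows "summable (\<lambda>k. (real k)\<^sup>2 * (\<rho> ^ k)\<^sup>2)"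
proof -
  \<comment> \<open>Half of the decay absorbs the polynomial factor, the other half gives a geometric series.\<close>
  define \<sigma> where "\<sigma> = sqrt \<rho>"
  have \<sigma>: "0 < \<sigma>" "\<sigma> < 1" "\<rho> = \<sigma>\<^sup>2" using assms by (auto simp: \<sigma>_def)
  have "(\<lambda>k. real k * \<sigma> ^ k) \<longlonglongrightarrow> 0"
    using powser_times_n_limit_0[of \<sigma>] \<sigma> by simp
  then have "Bseq (\<lambda>k. real k * \<sigma> ^ k)" using convergentI convergent_imp_Bseq by blast
  then obtain D where D: "\<And>k. norm (real k * \<sigma> ^ k) \<le> D" by (auto simp: Bseq_def)
  show ?thesis
  proof (rule summable_comparison_test')
    have "\<sigma>\<^sup>2 < 1" using \<sigma> by (simp add: power_less_one_iff)
    then show "summable (\<lambda>k. D\<^sup>2 * (\<sigma>\<^sup>2) ^ k)" by (intro summable_mult summable_geometric) auto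
    fix k
    have "(real k)\<^sup>2 * (\<rho> ^ k)\<^sup>2 = (real k * \<sigma> ^ k)\<^sup>2 * (\<sigma>\<^sup>2) ^ k"
      by (simp add: \<sigma>(3) power_mult_distrib flip: power_mult power_add)
    also have "\<dots> \<le> D\<^sup>2 * (\<sigma>\<^sup>2) ^ k"
      using D[of k] \<sigma> by (intro mult_right_mono power_mono) auto
    finally show "norm ((real k)\<^sup>2 * (\<rho> ^ k)\<^sup>2) \<le> D\<^sup>2 * (\<sigma>\<^sup>2) ^ k" by simp
  qed
qed

text \<open>
  Compare the truncation \<open>u\<close> with the exact solution. Cutting off changes each of the three values
  in the equation by at most \<open>C \<rho>\<^sup>N\<close>; within distance \<open>N\<close> of \<open>k\<close>, replacing \<open>W\<close> by \<open>V\<close> costs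
  another \<open>C \<rho>\<^sup>N\<close>.
\<close>

lemma truncation_residual:
  fixes F W V :: "int \<Rightarrow> complex"
  assumes sol: "\<And>m. nsa_anderson g W F m = z * F m"
    and decay: "\<And>m. cmod (F m) \<le> C * \<rho> ^ nat \<bar>m\<bar>" and \<rho>: "0 < \<rho>" "\<rho> < 1"
    and W: "\<And>m. cmod (W m) \<le> B"
    and close: "\<And>m. \<bar>m\<bar> \<le> int N \<Longrightarrow> cmod (W m - V (m + k)) \<le> \<rho> ^ N"
  defines "u \<equiv> \<lambda>x. if \<bar>x - k\<bar> \<le> int N then F (x - k) else 0"
  shows "cmod (nsa_anderson g V u x - z * u x) \<le> C * (exp (- g) + exp g + 1 + B + cmod z) * \<rho> ^ N"
proof -
  have C: "0 \<le> C" using order_trans[OF norm_ge_zero decay[of 0]] by simp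
  have B: "0 \<le> B" using W norm_ge_zero order_trans by blast
  have tail: "cmod (F m) \<le> C * \<rho> ^ N" if "\<not> \<bar>m\<bar> \<le> int N" for m
  proof -
    have "N \<le> nat \<bar>m\<bar>" using that by linarith
    then have "C * \<rho> ^ nat \<bar>m\<bar> \<le> C * \<rho> ^ N"
      using C \<rho> by (intro mult_left_mono power_decreasing) auto
    then show ?thesis using decay[of m] by linarith
  qed
  have cut: "cmod (u y - F (y - k)) \<le> C * \<rho> ^ N" for y
    using tail[of "y - k"] C \<rho> by (auto simp: u_def)
  define m where "m = x - k"
  define T where "T = (V x - z) * u x - (W m - z) * F m"
  have "nsa_anderson g V u x - z * u x = of_real (exp (- g)) * (u (x - 1) - F (m - 1))
      + of_real (exp g) * (u (x + 1) - F (m + 1)) + T"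
    using sol[of m] unfolding T_def nsa_anderson_def by algebra
  also have "cmod \<dots> \<le> exp (- g) * cmod (u (x - 1) - F (m - 1)) + exp g * cmod (u (x + 1) - F (m + 1)) + cmod T"
    by (rule order_trans[OF norm_triangle_ineq] add_mono norm_triangle_le)+ (auto simp: norm_mult)
  also have "\<dots> \<le> exp (- g) * (C * \<rho> ^ N) + exp g * (C * \<rho> ^ N) + (1 + B + cmod z) * (C * \<rho> ^ N)"
  proof (intro add_mono mult_left_mono)
    show "cmod (u (x - 1) - F (m - 1)) \<le> C * \<rho> ^ N" "cmod (u (x + 1) - F (m + 1)) \<le> C * \<rho> ^ N"
      using cut[of "x - 1"] cut[of "x + 1"] by (simp_all add: m_def algebra_simps)
    show "cmod T \<le> (1 + B + cmod z) * (C * \<rho> ^ N)"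
    proof (cases "\<bar>m\<bar> \<le> int N")
      case True
      have "C * \<rho> ^ nat \<bar>m\<bar> \<le> C" using C \<rho> by (intro mult_left_le power_le_one) auto
      then have F: "cmod (F m) \<le> C" using decay[of m] by linarith
      have "T = - ((W m - V (m + k)) * F m)"
        using True by (simp add: T_def u_def m_def algebra_simps)
      then have "cmod T = cmod (W m - V (m + k)) * cmod (F m)" by (simp add: norm_mult)
      also have "\<dots> \<le> \<rho> ^ N * C" using close[OF True] F \<rho> by (intro mult_mono) auto
      also have "\<dots> \<le> (1 + B + cmod z) * (C * \<rho> ^ N)"
        using C B \<rho> mult_right_mono[of 1 "1 + B + cmod z" "C * \<rho> ^ N"] by (simp add: mult.commute)
      finally show ?thesis .
    next
      case False
      then have "T = (z - W m) * F m" by (simp add: T_def u_def m_def algebra_simps)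
      then have "cmod T = cmod (z - W m) * cmod (F m)" by (simp add: norm_mult)
      also have "\<dots> \<le> (1 + B + cmod z) * (C * \<rho> ^ N)"
        using tail[OF False] W[of m] norm_triangle_ineq4[of z "W m"] B by (intro mult_mono) auto
      finally show ?thesis .
    qed
  qed auto
  finally show ?thesis by (simp add: algebra_simps)
qed

text \<open>
  The residual is supported on \<open>2 N + 3\<close> sites and is of order at most \<open>\<rho>\<^sup>N\<close> on each, so its norm tends to 0.
  Normalization is harmless: once \<open>N \<ge> \<bar>m\<^sub>0\<bar>\<close>, the norm of the truncation is at least \<open>\<bar>f m\<^sub>0\<bar>\<close>.
\<close>

lemma localized_spectrum_of_decaying_solution:
  assumes V: "pseudo_ergodic M V" and M: "bounded M"
    and W: "\<And>m. W m \<in> M"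
    and sol: "\<And>m. nsa_anderson g W f m = z * f m"
    and decay: "\<And>m. cmod (f m) \<le> C * \<rho> ^ nat \<bar>m\<bar>" and \<rho>: "0 < \<rho>" "\<rho> < 1"
    and nonzero: "f m\<^sub>0 \<noteq> 0"
  shows "z \<in> localized_spectrum (nsa_anderson g V)"
proof -
  define w where "w = (\<lambda>k. (real k)\<^sup>2 * (C * \<rho> ^ k)\<^sup>2)"
  define d where "d = cmod (f m\<^sub>0)"
  obtain B where B: "\<And>x. x \<in> M \<Longrightarrow> cmod x \<le> B" using M by (auto simp: bounded_iff)
  define K where "K = C / d * (exp (- g) + exp g + 1 + B + cmod z)"
  have d: "d > 0" using nonzero by (simp add: d_def)
  have "summable (\<lambda>k. C\<^sup>2 * ((real k)\<^sup>2 * (\<rho> ^ k)\<^sup>2))"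
    using summable_second_moment_geometric[OF \<rho>] by (rule summable_mult)
  then have w: "summable w" by (simp add: w_def power_mult_distrib algebra_simps)
  have C: "0 \<le> C" using order_trans[OF norm_ge_zero decay[of 0]] by simp
  have B0: "0 \<le> B" using B W norm_ge_zero order_trans by blast
  have K: "0 \<le> K" using C d B0 by (auto simp: K_def intro!: mult_nonneg_nonneg add_nonneg_nonneg)
  have approx: "\<exists>u. u \<in> l2 \<and> l2norm u = 1 \<and>
      l2norm (\<lambda>x. nsa_anderson g V u x - z * u x) \<le> K * (real (2 * N + 3) * \<rho> ^ N) \<and>
      l2var u \<le> ennreal (2 * suminf w / d\<^sup>2)"
    if N: "N \<ge> nat \<bar>m\<^sub>0\<bar>" for N
  proof -
    let ?I = "{- int N..int N}"
    have "\<exists>k. \<forall>m\<in>?I. cmod (W m - V (m + k)) < \<rho> ^ N"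
      using V [unfolded pseudo_ergodic_def, THEN conjunct2, rule_format, of "\<rho> ^ N" ?I W] \<rho> W
      by simp
    then obtain k where k: "\<And>m. m \<in> ?I \<Longrightarrow> cmod (W m - V (m + k)) < \<rho> ^ N"
      by blast
    define c where "c = sqrt (\<Sum>m\<in>?I. (cmod (f m))\<^sup>2)"
    have "(cmod (f m\<^sub>0))\<^sup>2 \<le> (\<Sum>m\<in>?I. (cmod (f m))\<^sup>2)"
      using N by (intro member_le_sum) auto
    then have dc: "d \<le> c" unfolding c_def d_def by (rule real_le_rsqrt)
    then have c: "c > 0" using d by simp
    define F where "F = (\<lambda>m. f m / of_real c)"
    define u where "u = (\<lambda>x. if \<bar>x - k\<bar> \<le> int N then F (x - k) else 0)"
    have F_sol: "nsa_anderson g W F m = z * F m" for m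
      using sol[of m] c by (simp add: F_def nsa_anderson_def field_simps)
    have F_decay: "cmod (F m) \<le> C / d * \<rho> ^ nat \<bar>m\<bar>" for m
    proof -
      have "cmod (F m) = cmod (f m) / c" using c by (simp add: F_def norm_divide)
      also have "\<dots> \<le> C * \<rho> ^ nat \<bar>m\<bar> / d" using decay[of m] dc d C \<rho> by (intro frac_le) auto
      finally show ?thesis by simp
    qed
    have bij: "bij_betw (\<lambda>m. m + k) ?I {k - int N..k + int N}"
      by (rule bij_betw_byWitness[where f' = "\<lambda>x. x - k"]) auto
    have supp: "u x = 0" if "x \<notin> {k - int N..k + int N}" for x using that by (auto simp: u_def)
    have sums: "(\<Sum>x\<in>{k - int N..k + int N}. h (x - k) * (cmod (u x))\<^sup>2) = (\<Sum>m\<in>?I. h m * (cmod (f m))\<^sup>2) / c\<^sup>2" for h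
    proof -
      have "(\<Sum>x\<in>{k - int N..k + int N}. h (x - k) * (cmod (u x))\<^sup>2) = (\<Sum>m\<in>?I. h (m + k - k) * (cmod (u (m + k)))\<^sup>2)"
        by (rule sum.reindex_bij_betw [OF bij, symmetric])
      also have "\<dots> = (\<Sum>m\<in>?I. h m * (cmod (f m))\<^sup>2 / c\<^sup>2)"
        using c by (intro sum.cong) (auto simp: u_def F_def norm_divide power_divide)
      finally show ?thesis by (simp add: sum_divide_distrib)
    qed
    have "u \<in> l2" 
      by (rule finite_support_l2norm(1)[of "{k - int N..k + int N}"]) (simp_all add: supp)
    moreover have "l2norm u = 1"
    proof -
      have "l2norm u = sqrt (\<Sum>x\<in>{k - int N..k + int N}. (cmod (u x))\<^sup>2)"
        by (rule finite_support_l2norm(2)[OF _ supp]) auto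
      also have "(\<Sum>x\<in>{k - int N..k + int N}. (cmod (u x))\<^sup>2) = c\<^sup>2 / c\<^sup>2"
        using sums[of "\<lambda>_. 1"] by (simp add: c_def sum_nonneg)
      finally show ?thesis using c by simp
    qed
    moreover have "l2norm (\<lambda>x. nsa_anderson g V u x - z * u x) \<le> K * (real (2 * N + 3) * \<rho> ^ N)"
    proof -
      let ?R = "\<lambda>x. nsa_anderson g V u x - z * u x" and ?S = "{k - int N - 1..k + int N + 1}"
      have R: "cmod (?R x) \<le> K * \<rho> ^ N" for x
        unfolding K_def u_def
        by (rule truncation_residual[OF F_sol F_decay \<rho> B[OF W]]) (use k in \<open>auto simp: less_imp_le abs_le_iff\<close>)
      have "l2norm ?R = sqrt (\<Sum>x\<in>?S. (cmod (?R x))\<^sup>2)"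
        by (rule finite_support_l2norm(2)) (auto simp: nsa_anderson_def u_def)
      also have "\<dots> \<le> (\<Sum>x\<in>?S. cmod (?R x))"
        unfolding L2_set_def [symmetric] by (rule L2_set_le_sum) simp
      also have "\<dots> \<le> of_nat (card ?S) * (K * \<rho> ^ N)"
        by (rule sum_bounded_above) (rule R)
      also have "card ?S = 2 * N + 3" by simp
      finally show ?thesis by (simp add: mult_ac)
    qed
    moreover have "l2var u \<le> ennreal (2 * suminf w / d\<^sup>2)"
    proof -
      have "l2var u \<le> l2moment u k" unfolding l2var_def by (rule INF_lower) simp
      also have "\<dots> = ennreal (\<Sum>x\<in>{k - int N..k + int N}. (real_of_int \<bar>x - k\<bar>)\<^sup>2 * (cmod (u x))\<^sup>2)"
        by (rule finite_support_l2moment[OF _ supp]) auto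
      also have "\<dots> \<le> ennreal (2 * suminf w / d\<^sup>2)"
      proof (rule ennreal_leI)
        have "(\<Sum>m\<in>?I. (real_of_int \<bar>m\<bar>)\<^sup>2 * (cmod (f m))\<^sup>2) \<le> (\<Sum>m\<in>?I. w (nat \<bar>m\<bar>))"
          unfolding w_def using decay by (intro sum_mono mult_mono power_mono) auto
        also have "\<dots> \<le> 2 * (\<Sum>k<Suc N. w k)" by (rule sum_symmetric_interval_le) (simp add: w_def)
        also have "\<dots> \<le> 2 * suminf w" using sum_le_suminf[OF w, of "{..<Suc N}"] by (simp add: w_def)
        finally have "(\<Sum>m\<in>?I. (real_of_int \<bar>m\<bar>)\<^sup>2 * (cmod (f m))\<^sup>2) / c\<^sup>2 \<le> 2 * suminf w / d\<^sup>2"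
          using dc d w by (intro frac_le power_mono mult_nonneg_nonneg suminf_nonneg) (auto simp: w_def)
        then show "(\<Sum>x\<in>{k - int N..k + int N}. (real_of_int \<bar>x - k\<bar>)\<^sup>2 * (cmod (u x))\<^sup>2) \<le> 2 * suminf w / d\<^sup>2"
          using sums[of "\<lambda>m. (real_of_int \<bar>m\<bar>)\<^sup>2"] by simp
      qed
      finally show ?thesis .
    qed
    ultimately show ?thesis by blast
  qed
  have "\<forall>j. \<exists>u. u \<in> l2 \<and> l2norm u = 1 \<and>
      l2norm (\<lambda>x. nsa_anderson g V u x - z * u x) \<le> K * (real (2 * (j + nat \<bar>m\<^sub>0\<bar>) + 3) * \<rho> ^ (j + nat \<bar>m\<^sub>0\<bar>)) \<and>
      l2var u \<le> ennreal (2 * suminf w / d\<^sup>2)"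
    by (intro allI approx) simp
  then obtain U where U: "\<And>j. U j \<in> l2" "\<And>j. l2norm (U j) = 1"
      "\<And>j. l2norm (\<lambda>x. nsa_anderson g V (U j) x - z * U j x)
        \<le> K * (real (2 * (j + nat \<bar>m\<^sub>0\<bar>) + 3) * \<rho> ^ (j + nat \<bar>m\<^sub>0\<bar>))"
      "\<And>j. l2var (U j) \<le> ennreal (2 * suminf w / d\<^sup>2)"
    by metis
  have "(\<lambda>N. 2 * (real N * \<rho> ^ N) + 3 * \<rho> ^ N) \<longlonglongrightarrow> 2 * 0 + 3 * 0"
    using powser_times_n_limit_0[of \<rho>] \<rho> by (intro tendsto_intros LIMSEQ_power_zero) auto
  then have "(\<lambda>N. K * (real (2 * N + 3) * \<rho> ^ N)) \<longlonglongrightarrow> 0"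
    by (intro tendsto_mult_right_zero) (simp add: algebra_simps)
  then have "(\<lambda>j. K * (real (2 * (j + nat \<bar>m\<^sub>0\<bar>) + 3) * \<rho> ^ (j + nat \<bar>m\<^sub>0\<bar>))) \<longlonglongrightarrow> 0"
    by (rule LIMSEQ_ignore_initial_segment)
  then have "(\<lambda>j. l2norm (\<lambda>x. nsa_anderson g V (U j) x - z * U j x)) \<longlonglongrightarrow> 0"
    by (rule tendsto_sandwich[OF _ _ tendsto_const, rotated 2])
       (use U(3) in \<open>auto simp: l2norm_def infsum_nonneg\<close>)
  moreover have "(SUP j. l2var (U j)) < \<infinity>"
    using SUP_least[of UNIV "\<lambda>j. l2var (U j)"] U(4) by (metis ennreal_less_top infinity_ennreal_def le_less_trans)
  ultimately show ?thesis unfolding localized_spectrum_def using U(1,2) by blast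
qed

section \<open>Gluing the two half lines\<close>

lemma I_set_solutions_decay:
  fixes as :: "complex list"
  assumes "g > 0" "as \<noteq> []" "z \<in> I_set g as"
    and u: "half_line_solution g z (\<lambda>m. as ! (m mod length as)) u"
  obtains C \<rho> where "0 < \<rho>" "\<rho> < 1" "\<And>m. cmod (u m) \<le> C * \<rho> ^ m"
proof -
  define n where "n = length as"
  have n: "n \<ge> 1" using assms(2) by (cases as) (auto simp: n_def)
  obtain \<mu> \<nu> where sum: "\<mu> + \<nu> = monodromy g as z $ 1 $ 1 + monodromy g as z $ 2 $ 2"
    and prod: "\<mu> * \<nu> = of_real (exp (- 2 * real n * g))"
    using roots_of_sum_and_product by blast
  have ins: "\<mu> + \<nu> \<in> inside (ellipse g n)" using assms(3) by (simp add: sum I_set_def n_def)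
  have "cmod \<mu> < 1" by (rule inside_ellipse_roots[OF \<open>g > 0\<close> n ins prod])
  moreover have "cmod \<nu> < 1"
    using inside_ellipse_roots[OF \<open>g > 0\<close> n, of \<nu> \<mu>] ins prod by (simp add: add.commute mult.commute)
  ultimately have "max (cmod \<mu>) (cmod \<nu>) < 1" by simp
  then obtain \<rho> where \<rho>: "0 < \<rho>" "\<rho> < 1" "max (cmod \<mu>) (cmod \<nu>) < \<rho> ^ n"
    using n by (rule obtain_root_above)
  then have \<mu>\<nu>: "cmod \<mu> < \<rho> ^ n" "cmod \<nu> < \<rho> ^ n" by auto
  have "u (m + n + n) - \<mu> * u (m + n) = \<nu> * (u (m + n) - \<mu> * u m)" for m
    using periodic_solution_recurrence[OF u assms(2) sum prod[unfolded n_def]] by (simp add: n_def)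
  then have "\<exists>D. \<forall>m. cmod (u (m + n) - \<mu> * u m) \<le> D * \<rho> ^ m"
    by (intro geometric_decay_of_recurrence[OF n \<rho>(1) \<mu>\<nu>(2), of _ 0]) simp
  then obtain D where "\<And>m. cmod (u (m + n) - \<mu> * u m) \<le> D * \<rho> ^ m" by blast
  then have "\<exists>C. \<forall>m. cmod (u m) \<le> C * \<rho> ^ m"
    by (rule geometric_decay_of_recurrence[OF n \<rho>(1) \<mu>\<nu>(1)])
  then show thesis using that \<rho>(1,2) by blast
qed

lemma O_set_growing_solution:
  fixes as :: "complex list"
  assumes "g > 0" "as \<noteq> []" "z \<in> O_set g as"
  obtains u \<mu> where "half_line_solution g z (\<lambda>m. as ! (m mod length as)) u" "u 0 \<noteq> 0 \<or> u 1 \<noteq> 0"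
    "cmod \<mu> > 1" "\<And>m. u (m + length as) = \<mu> * u m"
proof -
  define n where "n = length as"
  define W where "W = (\<lambda>m. as ! (m mod n))"
  define B where "B = monodromy g as z"
  have n: "n \<ge> 1" using assms(2) by (cases as) (auto simp: n_def)
  have "B $ 1 $ 1 + B $ 2 $ 2 \<in> outside (ellipse g n)"
    using assms(3) by (simp add: O_set_def B_def n_def)
  then obtain \<mu> \<nu> where \<mu>: "\<mu> + \<nu> = B $ 1 $ 1 + B $ 2 $ 2"
      "\<mu> * \<nu> = of_real (exp (- 2 * real n * g))" "cmod \<mu> > 1"
    by (rule outside_ellipse_root[OF \<open>g > 0\<close> n])
  have "\<mu> * \<nu> = det B" using \<mu>(2) by (simp add: B_def det_monodromy n_def)
  with \<mu>(1) obtain x y where xy: "x \<noteq> 0 \<or> y \<noteq> 0"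
    "x * B $ 1 $ 1 + y * B $ 2 $ 1 = \<mu> * x" "x * B $ 1 $ 2 + y * B $ 2 $ 2 = \<mu> * y"
    by (rule left_eigenvector_2)
  obtain u where u: "half_line_solution g z W u" "u 0 = x" "u 1 = y"
    using half_line_solution_exists by blast
  define w where "w = (\<lambda>m. 1 * u (m + n) + (- \<mu>) * u m)"
  have w: "half_line_solution g z W w"
    unfolding w_def
    by (intro half_line_solution_lincomb half_line_solution_shift u) (simp add: W_def)
  have "w 0 = 0" "w 1 = 0"
    using periodic_solution_monodromy[OF u(1)[unfolded W_def n_def] \<open>as \<noteq> []\<close>, of 0] xy u(2,3)
    by (simp_all add: w_def flip: n_def B_def)
  then have "w m = 0" for m using half_line_solution_zero w by blast
  then have "u (m + length as) = \<mu> * u m" for m by (simp add: w_def n_def)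
  then show thesis using that[of u \<mu>] u xy(1) \<mu>(3) by (simp add: W_def n_def)
qed

lemma nsa_anderson_of_recurrence:
  assumes "f (m + 1) = - of_real (exp (- 2 * g)) * f (m - 1) + of_real (exp (- g)) * (z - W m) * f m"
  shows "nsa_anderson g W f m = z * f m"
proof -
  have "of_real (exp g) * of_real (exp (- 2 * g)) = (of_real (exp (- g)) :: complex)"
    "of_real (exp g) * of_real (exp (- g)) = (1 :: complex)"
    by (simp_all flip: of_real_mult exp_add)
  moreover have "e' * x + e * (- e\<^sub>2 * x + e' * (z - w) * y) + w * y = z * y"
    if "e * e\<^sub>2 = e'" "e * e' = 1" for e e' e\<^sub>2 x y w :: complex
  proof -
    have "e * (- e\<^sub>2 * x + e' * (z - w) * y) = - (e * e\<^sub>2) * x + (e * e') * ((z - w) * y)"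
      by (simp add: algebra_simps)
    also have "\<dots> = - e' * x + (z - w) * y" by (simp only: that mult_1_left)
    finally show ?thesis by (simp add: algebra_simps)
  qed
  ultimately show ?thesis unfolding nsa_anderson_def assms by blast
qed

text \<open>
  The solution for \<open>\<beta>\<close> that is multiplied by \<open>\<mu>\<close> over each period extends to the left with factor
  \<open>1 / \<mu>\<close> per period. Its values at the sites \<open>- 1\<close> and \<open>0\<close> are the initial values on the right,
  where any solution for \<open>\<alpha>\<close> decays.
\<close>

lemma decaying_solution_exists:
  fixes \<alpha> \<beta> :: "complex list"
  assumes "g > 0" "\<alpha> \<noteq> []" "\<beta> \<noteq> []" "z \<in> I_set g \<alpha>" "z \<in> O_set g \<beta>"
  obtains W f C \<rho> m\<^sub>0 where "\<And>m. W m \<in> set \<alpha> \<union> set \<beta>"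
    "\<And>m. nsa_anderson g W f m = z * f m" "\<And>m. cmod (f m) \<le> C * \<rho> ^ nat \<bar>m\<bar>"
    "0 < \<rho>" "\<rho> < 1" "f m\<^sub>0 \<noteq> 0"
proof -
  define n p where "n = length \<alpha>" and "p = length \<beta>"
  have p: "p \<ge> 1" using assms(3) by (cases \<beta>) (auto simp: p_def)
  have n: "n \<ge> 1" using assms(2) by (cases \<alpha>) (auto simp: n_def)
  obtain u \<mu> where u: "half_line_solution g z (\<lambda>m. \<beta> ! (m mod p)) u" "u 0 \<noteq> 0 \<or> u 1 \<noteq> 0"
    "cmod \<mu> > 1" "\<And>m. u (m + p) = \<mu> * u m"
    using O_set_growing_solution[OF assms(1,3,5)] unfolding p_def by blast
  obtain a where a: "half_line_solution g z (\<lambda>m. \<alpha> ! (m mod n)) a" "a 0 = u 0" "a 1 = u 1"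
    using half_line_solution_exists by blast
  obtain C\<^sub>1 \<rho>\<^sub>1 where a_decay: "0 < \<rho>\<^sub>1" "\<rho>\<^sub>1 < 1" "\<And>m. cmod (a m) \<le> C\<^sub>1 * \<rho>\<^sub>1 ^ m"
    using I_set_solutions_decay[OF assms(1,2,4)] a(1) unfolding n_def by blast
  have \<mu>: "\<mu> \<noteq> 0" using u(3) by auto
  have u_shift: "u (m + j * p) = \<mu> ^ j * u m" for m j
  proof (induction j)
    case (Suc j)
    have "u (m + Suc j * p) = u (m + j * p + p)" by (simp add: algebra_simps)
    then show ?case using Suc u(4) by simp
  qed simp
  \<comment> \<open>The value at site \<open>- k\<close> of the extension of \<open>u\<close> to the left by \<open>u (m + p) = \<mu> * u m\<close>. Site \<open>- k\<close>
    has index \<open>1 - k\<close>, and shifting by \<open>k\<close> periods makes the index non-negative.\<close>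
  define b where "b = (\<lambda>k. u (k * (p - 1) + 1) / \<mu> ^ k)"
  have b_shift: "b k = u (k * (p - 1) + 1 + j * p) / \<mu> ^ (k + j)" for k j
    using \<mu> by (simp only: b_def u_shift) (simp add: power_add)
  have "cmod (inverse \<mu>) < 1" using u(3) by (simp add: norm_inverse inverse_less_1_iff)
  then obtain \<rho>\<^sub>2 where \<rho>\<^sub>2: "0 < \<rho>\<^sub>2" "\<rho>\<^sub>2 < 1" "cmod (inverse \<mu>) < \<rho>\<^sub>2 ^ p"
    using p by (rule obtain_root_above)
  have "b (k + p) = inverse \<mu> * b k" for k
  proof -
    have "(k + p) * (p - 1) + 1 = k * (p - 1) + 1 + (p - 1) * p"
      by (cases p) (simp_all add: algebra_simps)
    then have "b (k + p) = \<mu> ^ (p - 1) * u (k * (p - 1) + 1) / (\<mu> ^ k * \<mu> ^ Suc (p - 1))"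
      using p by (simp only: b_def u_shift) (simp add: power_add)
    then show ?thesis using \<mu> by (simp add: b_def field_simps)
  qed
  then have "\<exists>C. \<forall>k. cmod (b k) \<le> C * \<rho>\<^sub>2 ^ k"
    by (intro geometric_decay_of_recurrence[OF p \<rho>\<^sub>2(1,3), of _ 0]) simp
  then obtain C\<^sub>2 where b_decay: "\<And>k. cmod (b k) \<le> C\<^sub>2 * \<rho>\<^sub>2 ^ k" by blast
  define f where "f = (\<lambda>i. if i \<ge> 0 then a (Suc (nat i)) else b (nat (- i)))"
  define W where "W = (\<lambda>i. if i \<ge> 0 then \<alpha> ! (nat i mod n) else \<beta> ! nat (i mod int p))"
  have f_pos: "f (int m - 1) = a m" for m
  proof (cases m)
    case 0
    have "u p = \<mu> * u 0" using u(4)[of 0] by simp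
    then show ?thesis using 0 \<mu> p by (simp add: f_def b_def a)
  qed (simp add: f_def)
  have f_neg: "f (- int k) = b k" for k
    by (cases "k = 0") (use a in \<open>auto simp: f_def b_def\<close>)
  have sol: "nsa_anderson g W f i = z * f i" for i
  proof (rule nsa_anderson_of_recurrence, cases "i \<ge> 0")
    case True
    define m where "m = nat i"
    have i: "i = int m" using True by (simp add: m_def)
    have "f (i - 1) = a m" "f i = a (Suc m)" "f (i + 1) = a (Suc (Suc m))" "W i = \<alpha> ! (m mod n)"
      using f_pos[of m] by (auto simp: i f_def W_def nat_add_distrib)
    then show "f (i + 1) = - of_real (exp (- 2 * g)) * f (i - 1) + of_real (exp (- g)) * (z - W i) * f i"
      using a(1) by (simp add: half_line_solution_def)
  next
    case False
    \<comment> \<open>Shift all three values by the same number \<open>k + 2\<close> of periods, enough for site \<open>i - 1\<close>.\<close>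
    define k where "k = nat (- i) - 1"
    have i: "i = - int (Suc k)" using False by (simp add: k_def)
    define m where "m = Suc (Suc k) * (p - 1) + 1"
    have im: "int m = i + int (Suc (Suc k)) * int p"
      using p by (cases p) (simp_all add: m_def i algebra_simps)
    have "Suc k * (p - 1) + 1 + 1 * p = Suc m" "k * (p - 1) + 1 + 2 * p = Suc (Suc m)"
      using p by (cases p; simp add: m_def algebra_simps)+
    then have "f (i - 1) = u m / \<mu> ^ Suc (Suc k)" "f i = u (Suc m) / \<mu> ^ Suc (Suc k)"
      "f (i + 1) = u (Suc (Suc m)) / \<mu> ^ Suc (Suc k)"
      using f_neg[of "Suc (Suc k)"] f_neg[of "Suc k"] f_neg[of k] b_shift[of "Suc k" 1] b_shift[of k 2]
      by (simp_all add: i b_def m_def)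
    moreover have "W i = \<beta> ! (m mod p)"
    proof -
      have "int (m mod p) = i mod int p" by (simp only: zmod_int im mod_mult_self1)
      then show ?thesis using False by (metis W_def nat_int)
    qed
    ultimately show "f (i + 1) = - of_real (exp (- 2 * g)) * f (i - 1) + of_real (exp (- g)) * (z - W i) * f i"
      using u(1) by (simp add: half_line_solution_def add_divide_distrib diff_divide_distrib)
  qed
  define \<rho> C where "\<rho> = max \<rho>\<^sub>1 \<rho>\<^sub>2" and "C = max C\<^sub>1 C\<^sub>2"
  have "0 \<le> C\<^sub>1" using order_trans[OF norm_ge_zero a_decay(3)[of 0]] by simp
  have "0 \<le> C\<^sub>2" using order_trans[OF norm_ge_zero b_decay[of 0]] by simp
  have "cmod (f i) \<le> C * \<rho> ^ nat \<bar>i\<bar>" for i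
  proof (cases "i \<ge> 0")
    case True
    have "cmod (f i) \<le> C\<^sub>1 * \<rho>\<^sub>1 ^ Suc (nat i)" using True a_decay(3)[of "Suc (nat i)"] by (simp add: f_def)
    also have "\<dots> \<le> C\<^sub>1 * \<rho>\<^sub>1 ^ nat i"
      using \<open>0 \<le> C\<^sub>1\<close> a_decay(1,2) by (intro mult_left_mono power_decreasing) auto
    also have "\<dots> \<le> C * \<rho> ^ nat i"
      using \<open>0 \<le> C\<^sub>1\<close> a_decay(1) by (intro mult_mono power_mono) (auto simp: C_def \<rho>_def)
    finally show ?thesis using True by simp
  next
    case False
    have "cmod (f i) \<le> C\<^sub>2 * \<rho>\<^sub>2 ^ nat \<bar>i\<bar>" using False b_decay by (simp add: f_def)
    also have "\<dots> \<le> C * \<rho> ^ nat \<bar>i\<bar>"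
      using \<open>0 \<le> C\<^sub>2\<close> \<rho>\<^sub>2(1) by (intro mult_mono power_mono) (auto simp: C_def \<rho>_def)
    finally show ?thesis .
  qed
  moreover have "W i \<in> set \<alpha> \<union> set \<beta>" for i
  proof -
    have "nat i mod n < n" "nat (i mod int p) < p" using n p by (auto simp: nat_less_iff)
    then show ?thesis by (auto simp: W_def n_def p_def)
  qed
  moreover have "0 < \<rho>" "\<rho> < 1" using a_decay \<rho>\<^sub>2 by (auto simp: \<rho>_def)
  moreover have "f (- 1) \<noteq> 0 \<or> f 0 \<noteq> 0" using u(2) f_pos[of 0] f_pos[of 1] a by simp
  ultimately show thesis using that sol by blast
qed

theorem theorem12:
  fixes g :: real and M :: "complex set" and V :: "int \<Rightarrow> complex"
    and n p :: nat and \<alpha> \<beta> :: "complex list"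
  assumes "g > 0"
    and "compact M"
    and "pseudo_ergodic M V"
    and "n \<ge> 1" and "p \<ge> 1"
    and "length \<alpha> = n" and "set \<alpha> \<subseteq> M"
    and "length \<beta> = p" and "set \<beta> \<subseteq> M"
  shows "I_set g \<alpha> \<inter> O_set g \<beta> \<subseteq> localized_spectrum (nsa_anderson g V)"
proof
  fix z assume "z \<in> I_set g \<alpha> \<inter> O_set g \<beta>"
  moreover have "\<alpha> \<noteq> []" "\<beta> \<noteq> []" using assms(4-6,8) by auto
  ultimately obtain W f C \<rho> m\<^sub>0 where "\<And>m. W m \<in> set \<alpha> \<union> set \<beta>"
    "\<And>m. nsa_anderson g W f m = z * f m" "\<And>m. cmod (f m) \<le> C * \<rho> ^ nat \<bar>m\<bar>"
    "0 < \<rho>" "\<rho> < 1" "f m\<^sub>0 \<noteq> 0"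
    using decaying_solution_exists[OF \<open>g > 0\<close>] by (metis IntE)
  moreover have "W m \<in> M" for m
    using calculation(1) assms(7,9) by blast
  ultimately show "z \<in> localized_spectrum (nsa_anderson g V)"
    using localized_spectrum_of_decaying_solution[OF assms(3) compact_imp_bounded[OF assms(2)]] by blast
qed

end
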